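(* Consider a two-user Gaussian broadcast (BC) network with peak power constraint $P(t)\le\tilde P$ for all $t$, and the family of its dual multiple access (MAC) networks, i.e. MAC networks with per-user peak power constraints $P_1(t)\le\tilde P_1$, $P_2(t)\le\tilde P_2$ for all $t$ with $\tilde P_1+\tilde P_2=\tilde P$ (all networks as described in the context, with the same channel statistics, unit noise variance, and the same finite set of codebook rates at every MAC user and at the BC transmitter). Then the union, over all $(\tilde P_1,\tilde P_2)$ with $\tilde P_1,\tilde P_2\ge0$ and $\tilde P_1+\tilde P_2=\tilde P$, of the stability regions of these dual MAC networks is strictly contained in the stability region of the BC network.
   Context: Setting: time is slotted; in each slot each transmitter sends at most one fixed-length Gaussian codeword, with rate chosen from a common finite set $\mathcal{R}=\{0,R_0,\dots,R_{M-1}\}$ (rate $0$ = no transmission); the same set is used by both MAC users and for each user's codeword at the BC transmitter. The fading gain vector $\vec h(t)=(h_1(t),h_2(t))$ (Rayleigh fading) is stationary ergodic, constant during a slot, known to a centralized scheduler, and has identical statistics in the BC and MAC networks; all receivers have additive white Gaussian noise of unit variance; logs are base 2. Decoding is successive decoding with interference cancellation of whole codewords (no rate splitting). MAC (two transmitters, one receiver): under decoding order "user $j$ first, then $k$", rates $(r_1,r_2)$ are transmittable with powers $(P_1,P_2)$ iff $\log(1+h_j^2P_j/(1+h_k^2P_k))\ge r_j$ and $\log(1+h_k^2P_k)\ge r_k$; either order may be chosen each slot, and powers below the peak may be used. BC (one transmitter, two receivers, power split $P_1+P_2=P(t)$): if $h_1\ge h_2$, $(r_1,r_2)$ is transmittable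 iff $\log(1+h_1^2P_1)\ge r_1$ and $\log(1+h_2^2P_2/(1+h_2^2P_1))\ge r_2$, symmetrically if $h_2>h_1$. Stability region: the closure of the set of arrival rate vectors for which the user queues can be kept stable (a queue process $Q(t)$ is stable if $\lim_{x\to\infty}\limsup_{t\to\infty}\Pr[Q(t)>x]=0$) by some centralized scheduling policy with full knowledge of arrival statistics, queue and channel states; equivalently, the set of long-run average departure rate vectors achievable when all queues are infinitely backlogged. *)

theory Defs
  imports "HOL-Probability.Probability"
begin

text \<open>Channel gain process: a probability measure on streams of gain vectors (h1(t),h2(t)),
  i.e. the law of the (canonical) fading process. Stationarity and ergodicity w.r.t. the shift.\<close>

definition stationary_ergodic :: "(real \<times> real) stream measure \<Rightarrow> bool" where
  "stationary_ergodic \<mu> \<longleftrightarrow>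
     distr \<mu> (stream_space borel) stl = \<mu> \<and>
     (\<forall>A \<in> sets \<mu>. stl -` A \<inter> space \<mu> = A \<longrightarrow> measure \<mu> A = 0 \<or> measure \<mu> A = 1)"

definition rayleigh_density :: "real \<Rightarrow> real \<Rightarrow> ennreal" where
  "rayleigh_density \<sigma> x =
     (if x \<ge> 0 then ennreal (x / \<sigma>\<^sup>2 * exp (- (x\<^sup>2) / (2 * \<sigma>\<^sup>2))) else 0)"

text \<open>MAC: rate pair r transmittable in one slot with gains h under per-user peak powers,
  with either successive decoding order.\<close>
definition mac_transmittable ::
  "real set \<Rightarrow> real \<Rightarrow> real \<Rightarrow> real \<times> real \<Rightarrow> real \<times> real \<Rightarrow> bool" where
  "mac_transmittable R P1max P2max h r \<longleftrightarrow>
     fst r \<in> R \<and> snd r \<in> R \<and>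
     (\<exists>P1 P2. 0 \<le> P1 \<and> P1 \<le> P1max \<and> 0 \<le> P2 \<and> P2 \<le> P2max \<and>
        ((log 2 (1 + (fst h)\<^sup>2 * P1 / (1 + (snd h)\<^sup>2 * P2)) \<ge> fst r \<and>
          log 2 (1 + (snd h)\<^sup>2 * P2) \<ge> snd r) \<or>
         (log 2 (1 + (snd h)\<^sup>2 * P2 / (1 + (fst h)\<^sup>2 * P1)) \<ge> snd r \<and>
          log 2 (1 + (fst h)\<^sup>2 * P1) \<ge> fst r)))"

definition bc_transmittable ::
  "real set \<Rightarrow> real \<Rightarrow> real \<times> real \<Rightarrow> real \<times> real \<Rightarrow> bool" where
  "bc_transmittable R Pmax h r \<longleftrightarrow>
     fst r \<in> R \<and> snd r \<in> R \<and>
     (\<exists>P1 P2. 0 \<le> P1 \<and> 0 \<le> P2 \<and> P1 + P2 \<le> Pmax \<and>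
        (if fst h \<ge> snd h then
           log 2 (1 + (fst h)\<^sup>2 * P1) \<ge> fst r \<and>
           log 2 (1 + (snd h)\<^sup>2 * P2 / (1 + (snd h)\<^sup>2 * P1)) \<ge> snd r
         else
           log 2 (1 + (snd h)\<^sup>2 * P2) \<ge> snd r \<and>
           log 2 (1 + (fst h)\<^sup>2 * P1 / (1 + (fst h)\<^sup>2 * P2)) \<ge> fst r))"

definition causal_policy ::
  "(real \<times> real) stream measure \<Rightarrow> (nat \<Rightarrow> (real \<times> real) stream \<Rightarrow> real \<times> real) \<Rightarrow> bool" where
  "causal_policy \<mu> \<pi> \<longleftrightarrow>
     (\<forall>t. \<pi> t \<in> borel_measurable \<mu> \<and>
          (\<forall>\<omega> \<omega>'. stake (Suc t) \<omega> = stake (Suc t) \<omega>' \<longrightarrow> \<pi> t \<omega> = \<pi> t \<omega>'))"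

text \<open>Stability region: closure of the long-run average departure rate vectors achievable
  with infinitely backlogged queues, for per-slot feasibility predicate feas (gains, rates).\<close>
definition stability_region ::
  "(real \<times> real) stream measure \<Rightarrow> (real \<times> real \<Rightarrow> real \<times> real \<Rightarrow> bool) \<Rightarrow> (real \<times> real) set" where
  "stability_region \<mu> feas = closure {d. \<exists>\<pi>. causal_policy \<mu> \<pi> \<and>
      (\<forall>t \<omega>. feas (\<omega> !! t) (\<pi> t \<omega>)) \<and>
      (AE \<omega> in \<mu>. ((\<lambda>T. inverse (real T) *\<^sub>R (\<Sum>t<T. \<pi> t \<omega>)) \<longlonglongrightarrow> d))}"

end

theory Submission
  imports Defs "HOL-Real_Asymp.Real_Asymp"
begin

text \<open>Slot by slot, the minimal sum power of a MAC decoding order is at least the minimal BC power,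
  which gives the inclusion. Strictness is seen near the corner where only the first user is
  served at full power. Serving the second user exactly when \<open>h\<^sub>2 \<ge> K\<close> is an event of small
  probability \<open>p\<close>; the BC then trades a loss of order \<open>p\<close> for a gain of order \<open>p\<close>. A MAC that
  gives a fraction \<open>u\<close> of the power to the second user loses at least order \<open>u\<close> for the first
  user, because a gain just above the decoding threshold has probability of order \<open>u\<close>, but the
  second user earns at most order \<open>exp (- \<beta> / u)\<close>. So no MAC reaches the BC point for small
  \<open>p\<close>. Departure rates of MAC
  policies are bounded by taking expectations, while the BC point is attained by Birkhoff's
  theorem.\<close>

section \<open>Ergodic averages\<close>

text \<open>Ergodicity is stated for strictly invariant sets, as in
  \<open>stationary_ergodic\<close>. The exceptional set in the maximal argument below is strictly
  invariant as well.\<close>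

locale ergodic_system = prob_space M for M :: "'a measure" +
  fixes T :: "'a \<Rightarrow> 'a"
  assumes T_measurable [measurable]: "T \<in> M \<rightarrow>\<^sub>M M"
    and T_preserving: "distr M M T = M"
    and T_ergodic: "\<And>A. A \<in> sets M \<Longrightarrow> T -` A \<inter> space M = A \<Longrightarrow> prob A = 0 \<or> prob A = 1"
begin

lemma funpow_measurable [measurable]: "(T ^^ n) \<in> M \<rightarrow>\<^sub>M M"
proof (induction n)
  case (Suc n)
  then show ?case using measurable_comp[OF Suc T_measurable] by simp
qed (auto simp: id_def)

lemma funpow_preserving: "distr M M (T ^^ n) = M"
proof (induction n)
  case 0
  then show ?case by (simp add: distr_id2 id_def)
next
  case (Suc n)
  have "distr M M (T ^^ Suc n) = distr (distr M M (T ^^ n)) M T"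
    by (simp add: distr_distr)
  also have "\<dots> = M" by (simp add: Suc T_preserving)
  finally show ?case .
qed

lemma integral_funpow:
  fixes f :: "'a \<Rightarrow> real"
  assumes [measurable]: "f \<in> borel_measurable M"
  shows "(\<integral>x. f ((T ^^ n) x) \<partial>M) = (\<integral>x. f x \<partial>M)"
  using integral_distr[of "T ^^ n" M M f] by (simp add: funpow_preserving)

lemma AE_funpow:
  assumes "AE x in M. P x"
  shows "AE x in M. P ((T ^^ n) x)"
proof -
  have "AE x in distr M M (T ^^ n). P x"
    using assms unfolding funpow_preserving .
  then show ?thesis by (rule AE_distrD[OF funpow_measurable])
qed

text \<open>The running maximum \<open>m n\<close> of the partial sums satisfies
  \<open>m (n+1) - m n \<circ> T = max (- m n \<circ> T) g\<close>, whose integral is nonnegative because \<open>m\<close> is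
  increasing and \<open>T\<close> preserves the measure. If the partial sums were unbounded on the invariant
  set of full measure, the right-hand side would converge to \<open>g\<close>, forcing \<open>\<integral>g \<ge> 0\<close>.\<close>

lemma AE_partial_sums_bdd_above:
  fixes g :: "'a \<Rightarrow> real"
  assumes g [measurable]: "g \<in> borel_measurable M"
    and bounded: "\<And>x. x \<in> space M \<Longrightarrow> \<bar>g x\<bar> \<le> B"
    and negative: "(\<integral>x. g x \<partial>M) < 0"
  shows "AE x in M. bdd_above (range (\<lambda>n. \<Sum>k<n. g ((T ^^ k) x)))"
proof -
  \<comment> \<open>Maximum of 0 and the first \<open>n\<close> partial sums. The recursion peels
    off the first term, so the remaining sums start at \<open>T x\<close>.\<close>
  define m where "m = rec_nat (\<lambda>x. 0) (\<lambda>n f x. max 0 (g x + f (T x)))"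
  have m0: "m 0 x = 0" and mS: "m (Suc n) x = max 0 (g x + m n (T x))" for n x
    by (simp_all add: m_def)
  have Tsp: "T x \<in> space M" if "x \<in> space M" for x
    using measurable_space[OF T_measurable that] .
  have m_meas [measurable]: "m n \<in> borel_measurable M" for n
  proof (induction n)
    case 0
    have "m 0 = (\<lambda>x. 0)" by (auto simp: m0)
    then show ?case by simp
  next
    case (Suc n)
    note [measurable] = Suc
    have "m (Suc n) = (\<lambda>x. max 0 (g x + m n (T x)))" by (auto simp: mS)
    then show ?case by simp
  qed
  have m_nonneg: "0 \<le> m n x" for n x
    by (cases n) (auto simp: m0 mS)
  have m_incr: "m n x \<le> m (Suc n) x" for n x
  proof (induction n arbitrary: x)
    case (Suc n)
    have "m (Suc n) x = max 0 (g x + m n (T x))" by (rule mS)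
    also have "\<dots> \<le> max 0 (g x + m (Suc n) (T x))" using Suc[of "T x"] by linarith
    also have "\<dots> = m (Suc (Suc n)) x" by (rule mS[symmetric])
    finally show ?case .
  qed (simp add: m0 m_nonneg)
  have B: "0 \<le> B" using bounded not_empty by fastforce
  have m_bound: "\<bar>m n x\<bar> \<le> B * n" if "x \<in> space M" for n x
    using that
  proof (induction n arbitrary: x)
    case (Suc n)
    have "\<bar>m n (T x)\<bar> \<le> B * n" using Suc Tsp by blast
    with bounded[OF Suc.prems] have "g x + m n (T x) \<le> B * Suc n"
      by (simp add: algebra_simps)
    then show ?case using B by (simp add: mS)
  qed (simp add: m0)
  have m_int: "integrable M (m n)" for n
    by (rule integrable_const_bound[where B = "B * n"]) (auto intro: m_bound)
  have sum_le: "(\<Sum>k<n. g ((T ^^ k) x)) \<le> m n x" for n x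
  proof (induction n arbitrary: x)
    case (Suc n)
    have "(\<Sum>k<Suc n. g ((T ^^ k) x)) = g x + (\<Sum>k<n. g ((T ^^ k) (T x)))"
      by (subst sum.lessThan_Suc_shift) (simp add: funpow_swap1)
    also have "\<dots> \<le> m (Suc n) x" using Suc[of "T x"] by (simp add: mS)
    finally show ?case .
  qed (simp add: m0)
  define E where "E = {x \<in> space M. \<forall>j::nat. \<exists>n. real j < m n x}"
  have E_sets: "E \<in> sets M" unfolding E_def by measurable
  \<comment> \<open>While \<open>m (Suc n) x\<close> is positive it equals
    \<open>g x + m n (T x)\<close>, so unboundedness passes between \<open>x\<close> and
    \<open>T x\<close> in both directions.\<close>
  have E_inv: "T x \<in> E \<longleftrightarrow> x \<in> E" if x: "x \<in> space M" for x
  proof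
    assume *: "T x \<in> E"
    have "\<exists>n. real j < m n x" for j
    proof -
      obtain l :: nat where l: "real j - g x < real l" using reals_Archimedean2 by blast
      obtain n where "real l < m n (T x)" using * E_def by blast
      then have "real j < m (Suc n) x" using l by (simp add: mS)
      then show ?thesis ..
    qed
    then show "x \<in> E" using x by (simp add: E_def)
  next
    assume *: "x \<in> E"
    have "\<exists>n. real j < m n (T x)" for j
    proof -
      obtain l :: nat where l: "real j + \<bar>g x\<bar> < real l" using reals_Archimedean2 by blast
      obtain n where n: "real l < m n x" using * E_def by blast
      then obtain k where "n = Suc k" by (cases n) (auto simp: m0)
      then have "real j < m k (T x)" using l n by (simp add: mS)
      then show ?thesis ..
    qed
    then show "T x \<in> E" using x Tsp by (simp add: E_def)
  qed
  have "T -` E \<inter> space M = E" using E_inv by (auto simp: E_def)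
  from T_ergodic[OF E_sets this] have "prob E = 0"
  proof
    assume "prob E = 1"
    then have E1: "AE x in M. x \<in> E" using prob_eq_1 E_sets by blast
    have "(\<lambda>n. \<integral>x. max (- m n (T x)) (g x) \<partial>M) \<longlonglongrightarrow> (\<integral>x. g x \<partial>M)"
    proof (rule integral_dominated_convergence[where w = "\<lambda>_. B"])
      show "AE x in M. (\<lambda>n. max (- m n (T x)) (g x)) \<longlonglongrightarrow> g x"
        using E1
      proof eventually_elim
        case (elim x)
        then have "T x \<in> E" using E_inv E_def by blast
        obtain l :: nat where l: "\<bar>g x\<bar> < real l" using reals_Archimedean2 by blast
        obtain N where N: "real l < m N (T x)" using \<open>T x \<in> E\<close> E_def by blast
        have "max (- m n (T x)) (g x) = g x" if "N \<le> n" for n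
        proof -
          have "m N (T x) \<le> m n (T x)"
            using m_incr that by (rule lift_Suc_mono_le[of "\<lambda>n. m n (T x)"])
          with N l have "- m n (T x) \<le> g x" by linarith
          then show ?thesis by simp
        qed
        then have "eventually (\<lambda>n. max (- m n (T x)) (g x) = g x) sequentially"
          by (auto simp: eventually_sequentially)
        then show ?case by (simp add: tendsto_eventually)
      qed
      \<comment> \<open>Since \<open>m\<close> is nonnegative, this maximum lies between
        \<open>g x\<close> and \<open>max 0 (g x)\<close>.\<close>
      show "AE x in M. norm (max (- m n (T x)) (g x)) \<le> B" for n
      proof (rule AE_I2)
        fix x assume "x \<in> space M"
        from bounded[OF this] m_nonneg[of n "T x"]
        show "norm (max (- m n (T x)) (g x)) \<le> B" by (simp add: max_def abs_le_iff)
      qed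
    qed auto
    moreover have "0 \<le> (\<integral>x. max (- m n (T x)) (g x) \<partial>M)" for n
    proof -
      have int_T: "integrable M (\<lambda>x. m n (T x))"
        using bounded Tsp by (intro integrable_const_bound[where B = "B * n"]) (auto intro: m_bound)
      have "(\<integral>x. max (- m n (T x)) (g x) \<partial>M) = (\<integral>x. m (Suc n) x - m n (T x) \<partial>M)"
        by (intro Bochner_Integration.integral_cong) (auto simp: mS)
      also have "\<dots> = (\<integral>x. m (Suc n) x \<partial>M) - (\<integral>x. m n x \<partial>M)"
        using integral_funpow[of "m n" 1] by (simp add: m_int int_T)
      also have "\<dots> \<ge> 0" using integral_mono[OF m_int m_int m_incr] by simp
      finally show ?thesis .
    qed
    ultimately have "0 \<le> (\<integral>x. g x \<partial>M)" by (intro LIMSEQ_le_const) auto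
    with negative show ?thesis by simp
  qed
  then have "AE x in M. x \<notin> E"
    using prob_eq_0[OF E_sets] by simp
  then show ?thesis
  proof (rule AE_mp, intro AE_I2 impI)
    fix x assume "x \<in> space M" "x \<notin> E"
    then obtain j where "\<And>n. m n x \<le> real j" by (auto simp: E_def not_less)
    then show "bdd_above (range (\<lambda>n. \<Sum>k<n. g ((T ^^ k) x)))"
      using sum_le by (intro bdd_aboveI[where M = "real j"]) (auto intro: order_trans)
  qed
qed

text \<open>Subtracting the mean plus \<open>e / 2\<close> from \<open>f\<close> leaves a negative
  integral. The partial sums of the difference are then bounded above by some \<open>C\<close>, so
  the averages exceed the mean plus \<open>e / 2\<close> by at most \<open>C / n\<close>, which
  drops below \<open>e / 2\<close>.\<close>

lemma AE_average_eventually_less: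
  fixes f :: "'a \<Rightarrow> real"
  assumes f [measurable]: "f \<in> borel_measurable M"
    and bounded: "\<And>x. x \<in> space M \<Longrightarrow> \<bar>f x\<bar> \<le> B" and e: "e > 0"
  shows "AE x in M. eventually (\<lambda>n. (\<Sum>k<n. f ((T ^^ k) x)) / n < (\<integral>x. f x \<partial>M) + e) sequentially"
proof -
  let ?I = "\<integral>x. f x \<partial>M"
  define g where "g x = f x - (?I + e / 2)" for x
  have f_int: "integrable M f"
    by (rule integrable_const_bound[where B = B]) (auto intro: bounded)
  have "AE x in M. bdd_above (range (\<lambda>n. \<Sum>k<n. g ((T ^^ k) x)))"
  proof (rule AE_partial_sums_bdd_above[where B = "B + \<bar>?I + e / 2\<bar>"])
    show "g \<in> borel_measurable M" unfolding g_def by measurable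
    show "\<bar>g x\<bar> \<le> B + \<bar>?I + e / 2\<bar>" if "x \<in> space M" for x
      using bounded[OF that] by (simp add: g_def)
    show "(\<integral>x. g x \<partial>M) < 0"
      using f_int e by (simp add: g_def prob_space)
  qed
  then show ?thesis
  proof eventually_elim
    case (elim x)
    then obtain C where C: "\<And>n. (\<Sum>k<n. g ((T ^^ k) x)) \<le> C" by (auto simp: bdd_above_def)
    obtain N :: nat where N: "2 * \<bar>C\<bar> / e < N" using reals_Archimedean2 by blast
    have "(\<Sum>k<n. f ((T ^^ k) x)) / n < ?I + e" if "n \<ge> Suc N" for n
    proof -
      have "2 * \<bar>C\<bar> / e < n" using N that by linarith
      then have "C < n * (e / 2)" using e by (simp add: field_simps)
      moreover have "(\<Sum>k<n. f ((T ^^ k) x)) - n * (?I + e / 2) \<le> C"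
        using C[of n] by (simp add: g_def sum_subtractf)
      ultimately have "(\<Sum>k<n. f ((T ^^ k) x)) < (?I + e) * n" by (simp add: algebra_simps)
      then show ?thesis using that by (simp add: pos_divide_less_eq)
    qed
    then show ?case unfolding eventually_sequentially by blast
  qed
qed

text \<open>The one-sided estimate is applied to \<open>f\<close> and to \<open>- f\<close>. Taking
  the errors \<open>1 / (j + 1)\<close> leaves only countably many null sets to discard.\<close>

theorem birkhoff_bounded:
  fixes f :: "'a \<Rightarrow> real"
  assumes f [measurable]: "f \<in> borel_measurable M"
    and bounded: "\<And>x. x \<in> space M \<Longrightarrow> \<bar>f x\<bar> \<le> B"
  shows "AE x in M. (\<lambda>n. (\<Sum>k<n. f ((T ^^ k) x)) / n) \<longlonglongrightarrow> (\<integral>x. f x \<partial>M)"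
proof -
  let ?I = "\<integral>x. f x \<partial>M"
  have "AE x in M. \<forall>j. eventually (\<lambda>n. (\<Sum>k<n. f ((T ^^ k) x)) / n < ?I + inverse (Suc j)) sequentially"
    unfolding AE_all_countable
    by (intro allI AE_average_eventually_less[where B = B]) (auto intro: bounded)
  moreover have "AE x in M. \<forall>j. eventually (\<lambda>n. (\<Sum>k<n. - f ((T ^^ k) x)) / n
      < (\<integral>x. - f x \<partial>M) + inverse (Suc j)) sequentially"
    unfolding AE_all_countable
    by (intro allI AE_average_eventually_less[where B = B]) (auto intro: bounded)
  ultimately show ?thesis
  proof eventually_elim
    case (elim x)
    show ?case
    proof (rule LIMSEQ_I)
      fix r :: real assume "0 < r"
      then obtain j where j: "inverse (real (Suc j)) < r" using reals_Archimedean by blast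
      have "eventually (\<lambda>n. norm ((\<Sum>k<n. f ((T ^^ k) x)) / n - ?I) < r) sequentially"
        using elim(1)[rule_format, of j] elim(2)[rule_format, of j]
        by eventually_elim (use j in \<open>simp add: sum_negf abs_less_iff\<close>)
      then show "\<exists>no. \<forall>n\<ge>no. norm ((\<Sum>k<n. f ((T ^^ k) x)) / n - ?I) < r"
        by (simp add: eventually_sequentially)
    qed
  qed
qed

text \<open>Serves for policies that depend on the whole past, where \<open>f t\<close> need not be
  a shifted copy of one function. Expectations suffice: dominated convergence moves the limit
  outside, and each \<open>f t\<close> has mean at most that of \<open>g\<close> by
  invariance.\<close>

lemma average_limit_le_integral:
  fixes f :: "nat \<Rightarrow> 'a \<Rightarrow> real" and g :: "'a \<Rightarrow> real"
  assumes [measurable]: "\<And>t. f t \<in> borel_measurable M" "g \<in> borel_measurable M"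
    and bounded: "\<And>t x. x \<in> space M \<Longrightarrow> \<bar>f t x\<bar> \<le> B" "\<And>x. x \<in> space M \<Longrightarrow> \<bar>g x\<bar> \<le> B"
    and le: "\<And>t x. x \<in> space M \<Longrightarrow> f t x \<le> g ((T ^^ t) x)"
    and lim: "AE x in M. (\<lambda>n. (\<Sum>t<n. f t x) / n) \<longlonglongrightarrow> d"
  shows "d \<le> (\<integral>x. g x \<partial>M)"
proof -
  have f_int: "integrable M (f t)" for t
    by (rule integrable_const_bound[where B = B]) (auto intro: bounded)
  have g_int: "integrable M (\<lambda>x. g ((T ^^ t) x))" for t
    by (rule integrable_const_bound[where B = B])
       (auto intro!: bounded measurable_space[OF funpow_measurable])
  have avg_bound: "\<bar>(\<Sum>t<n. f t x) / n\<bar> \<le> B" if "x \<in> space M" for n x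
  proof (cases "n = 0")
    case True
    then show ?thesis using bounded(2)[OF that] by simp
  next
    case False
    have "\<bar>\<Sum>t<n. f t x\<bar> \<le> (\<Sum>t<n. \<bar>f t x\<bar>)" by (rule sum_abs)
    also have "\<dots> \<le> (\<Sum>t<n. B)" by (intro sum_mono bounded that)
    finally show ?thesis using False by (simp add: abs_divide field_simps)
  qed
  have "(\<lambda>n. \<integral>x. (\<Sum>t<n. f t x) / n \<partial>M) \<longlonglongrightarrow> (\<integral>x. d \<partial>M)"
    by (rule integral_dominated_convergence[where w = "\<lambda>_. B"])
       (use lim avg_bound in \<open>auto intro!: AE_I2\<close>)
  then have "(\<lambda>n. \<integral>x. (\<Sum>t<n. f t x) / n \<partial>M) \<longlonglongrightarrow> d" by (simp add: prob_space)
  \<comment> \<open>At \<open>n = 0\<close> the quotient is 0, which may exceed the integral of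
    \<open>g\<close>.\<close>
  moreover have "(\<integral>x. (\<Sum>t<n. f t x) / n \<partial>M) \<le> (\<integral>x. g x \<partial>M)" if "n \<ge> 1" for n :: nat
  proof -
    have "(\<integral>x. (\<Sum>t<n. f t x) / n \<partial>M) = (\<Sum>t<n. \<integral>x. f t x \<partial>M) / n"
      using f_int by (simp add: Bochner_Integration.integral_sum)
    also have "\<dots> \<le> (\<Sum>t<n. \<integral>x. g ((T ^^ t) x) \<partial>M) / n"
      by (intro divide_right_mono sum_mono integral_mono f_int g_int le) auto
    also have "\<dots> = (\<integral>x. g x \<partial>M)" using that by (simp add: integral_funpow)
    finally show ?thesis .
  qed
  ultimately show ?thesis by (intro LIMSEQ_le_const2) auto
qed

end

section \<open>From the stationary ergodic gain process to the shift system\<close>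

lemma stationary_ergodic_system:
  assumes "prob_space \<mu>" and S: "sets \<mu> = sets (stream_space borel)" and "stationary_ergodic \<mu>"
  shows "ergodic_system \<mu> stl"
proof -
  interpret prob_space \<mu> by fact
  have "distr \<mu> \<mu> stl = distr \<mu> (stream_space borel) stl"
    by (intro distr_cong S refl)
  moreover have "stl \<in> \<mu> \<rightarrow>\<^sub>M \<mu>"
    using measurable_cong_sets[OF S S] measurable_stl by blast
  ultimately show ?thesis
    using assms(3) by unfold_locales (auto simp: stationary_ergodic_def)
qed

section \<open>Rayleigh tails\<close>

lemma rayleigh_density_measurable [measurable]: "rayleigh_density \<sigma> \<in> borel_measurable borel"
  unfolding rayleigh_density_def[abs_def] by measurable

text \<open>The density is the derivative of
  \<open>- exp (- y\<^sup>2 / (2 * \<sigma>\<^sup>2))\<close>, which vanishes at infinity.\<close>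

lemma emeasure_rayleigh_atLeast:
  assumes "\<sigma> > 0" and "x \<ge> 0"
  shows "emeasure (density lborel (rayleigh_density \<sigma>)) {x..} = ennreal (exp (- x\<^sup>2 / (2 * \<sigma>\<^sup>2)))"
proof -
  have "emeasure (density lborel (rayleigh_density \<sigma>)) {x..}
      = (\<integral>\<^sup>+y. rayleigh_density \<sigma> y * indicator {x..} y \<partial>lborel)"
    by (simp add: emeasure_density)
  also have "\<dots> = (\<integral>\<^sup>+y. ennreal (y / \<sigma>\<^sup>2 * exp (- (y\<^sup>2) / (2 * \<sigma>\<^sup>2))) * indicator {x..} y \<partial>lborel)"
    using assms by (intro nn_integral_cong) (auto simp: rayleigh_density_def indicator_def)
  also have "\<dots> = ennreal (0 - (- exp (- x\<^sup>2 / (2 * \<sigma>\<^sup>2))))"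
  proof (rule nn_integral_FTC_atLeast)
    fix y assume "x \<le> y"
    show "((\<lambda>y. - exp (- y\<^sup>2 / (2 * \<sigma>\<^sup>2))) has_real_derivative
        y / \<sigma>\<^sup>2 * exp (- (y\<^sup>2) / (2 * \<sigma>\<^sup>2))) (at y)"
      using assms by (auto intro!: derivative_eq_intros simp: field_simps power2_eq_square)
    show "0 \<le> y / \<sigma>\<^sup>2 * exp (- (y\<^sup>2) / (2 * \<sigma>\<^sup>2))" using \<open>x \<le> y\<close> assms by simp
  next
    have "filterlim (\<lambda>y. - y\<^sup>2 / (2 * \<sigma>\<^sup>2)) at_bot at_top"
      using assms by real_asymp
    from tendsto_minus[OF filterlim_compose[OF exp_at_bot this]]
    show "((\<lambda>y. - exp (- y\<^sup>2 / (2 * \<sigma>\<^sup>2))) \<longlongrightarrow> 0) at_top" by simp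
  qed simp
  finally show ?thesis by simp
qed

lemma (in prob_space) rayleigh_prob_atLeast:
  assumes "random_variable borel X" and "distr M borel X = density lborel (rayleigh_density \<sigma>)"
    and "\<sigma> > 0" and "x \<ge> 0"
  shows "prob {\<omega> \<in> space M. x \<le> X \<omega>} = exp (- x\<^sup>2 / (2 * \<sigma>\<^sup>2))"
proof -
  have "emeasure M {\<omega> \<in> space M. x \<le> X \<omega>} = emeasure (distr M borel X) {x..}"
    using assms(1) by (subst emeasure_distr) (auto intro: arg_cong[where f = "emeasure M"])
  then show ?thesis using emeasure_rayleigh_atLeast[OF assms(3,4)] assms(2)
    by (simp add: measure_def)
qed

lemma (in prob_space) rayleigh_prob_atLeastLessThan:
  assumes "random_variable borel X" and "distr M borel X = density lborel (rayleigh_density \<sigma>)"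
    and "\<sigma> > 0" and "x \<ge> 0" and "x \<le> y"
  shows "prob {\<omega> \<in> space M. x \<le> X \<omega> \<and> X \<omega> < y}
      = exp (- x\<^sup>2 / (2 * \<sigma>\<^sup>2)) - exp (- y\<^sup>2 / (2 * \<sigma>\<^sup>2))"
proof -
  note [measurable] = assms(1)
  have "{\<omega> \<in> space M. x \<le> X \<omega> \<and> X \<omega> < y}
      = {\<omega> \<in> space M. x \<le> X \<omega>} - {\<omega> \<in> space M. y \<le> X \<omega>}"
    by auto
  then have "prob {\<omega> \<in> space M. x \<le> X \<omega> \<and> X \<omega> < y}
      = prob {\<omega> \<in> space M. x \<le> X \<omega>} - prob {\<omega> \<in> space M. y \<le> X \<omega>}"
    using assms(5) by (simp add: finite_measure_Diff Collect_mono)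
  then show ?thesis
    using rayleigh_prob_atLeast[OF assms(1-3)] assms(4,5) by simp
qed

text \<open>The tail from 0 on has probability 1. This matters because the BC decoding order
  compares the gains, whereas the rates depend on their squares.\<close>

lemma (in prob_space) rayleigh_AE_nonneg:
  assumes "random_variable borel X" and "distr M borel X = density lborel (rayleigh_density \<sigma>)"
    and "\<sigma> > 0"
  shows "AE \<omega> in M. 0 \<le> X \<omega>"
proof -
  note [measurable] = assms(1)
  have "prob {\<omega> \<in> space M. 0 \<le> X \<omega>} = 1"
    using rayleigh_prob_atLeast[OF assms, of 0] by simp
  then have "AE \<omega> in M. \<omega> \<in> {\<omega> \<in> space M. 0 \<le> X \<omega>}" by (subst prob_eq_1[symmetric]) auto
  then show ?thesis by eventually_elim simp
qed

section \<open>Transmittable rates in a single slot\<close>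

text \<open>Replaces each rate by the signal-to-noise ratio it requires, so that decodability
  becomes algebraic in the powers.\<close>

lemma rate_le_log_iff: "s \<ge> 0 \<Longrightarrow> r \<le> log 2 (1 + s) \<longleftrightarrow> 2 powr r - 1 \<le> s"
  by (subst le_log_iff) auto

text \<open>The left-hand side of the conclusion is the minimal BC power. It equals the minimal MAC
  power when the user with the larger gain is decoded first; the other order needs more power.\<close>

lemma bc_power_le_mac_power:
  fixes a b g1 g2 P1 P2 :: real
  assumes "a \<ge> 0" "b \<ge> 0" "g1 > 0" "g2 > 0" "P1 \<ge> 0" "P2 \<ge> 0"
    and mac: "(a \<le> g1 * P1 / (1 + g2 * P2) \<and> b \<le> g2 * P2)
      \<or> (b \<le> g2 * P2 / (1 + g1 * P1) \<and> a \<le> g1 * P1)"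
    and "g2 \<le> g1"
  shows "a / g1 + b * (1 + g2 * (a / g1)) / g2 \<le> P1 + P2"
proof -
  have pos: "1 + g2 * P2 > 0" "1 + g1 * P1 > 0" using assms by (simp_all add: add_pos_nonneg)
  \<comment> \<open>Only the cross term \<open>a * b / g1\<close> depends on the decoding
    order.\<close>
  have eq: "a / g1 + b * (1 + g2 * (a / g1)) / g2 = a / g1 + b / g2 + a * b / g1"
    using assms by (simp add: field_simps)
  from mac show ?thesis
  proof
    assume *: "a \<le> g1 * P1 / (1 + g2 * P2) \<and> b \<le> g2 * P2"
    then have "a * (1 + g2 * P2) \<le> g1 * P1" using pos by (simp add: pos_le_divide_eq)
    moreover have "a * (1 + b) \<le> a * (1 + g2 * P2)" using * assms by (intro mult_left_mono) auto
    ultimately have "a * (1 + b) / g1 \<le> P1" using assms by (simp add: pos_divide_le_eq mult.commute)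
    moreover have "b / g2 \<le> P2" using * assms by (simp add: pos_divide_le_eq mult.commute)
    ultimately show ?thesis unfolding eq by (simp add: distrib_left add_divide_distrib)
  next
    assume *: "b \<le> g2 * P2 / (1 + g1 * P1) \<and> a \<le> g1 * P1"
    then have "b * (1 + g1 * P1) \<le> g2 * P2" using pos by (simp add: pos_le_divide_eq)
    moreover have "b * (1 + a) \<le> b * (1 + g1 * P1)" using * assms by (intro mult_left_mono) auto
    ultimately have "b * (1 + a) / g2 \<le> P2" using assms by (simp add: pos_divide_le_eq mult.commute)
    moreover have "a / g1 \<le> P1" using * assms by (simp add: pos_divide_le_eq mult.commute)
    \<comment> \<open>Decoding the weaker user first puts the smaller gain \<open>g2\<close> under
      the cross term, hence the larger power.\<close>
    moreover have "a * b / g1 \<le> a * b / g2" using assms by (intro divide_left_mono) auto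
    ultimately show ?thesis unfolding eq by (simp add: distrib_left add_divide_distrib mult.commute)
  qed
qed

text \<open>The stronger user gets the least power that works without interference; the other gets
  the least power that works against the interference so created. A zero gain \<open>g2\<close> is
  treated apart, as it forces \<open>b = 0\<close> and the formula for \<open>Q2\<close> divides by
  it.\<close>

lemma bc_allocation_exists:
  fixes a b g1 g2 P1 P2 :: real
  assumes "a \<ge> 0" "b \<ge> 0" "g1 \<ge> 0" "g2 \<ge> 0" "P1 \<ge> 0" "P2 \<ge> 0"
    and mac: "(a \<le> g1 * P1 / (1 + g2 * P2) \<and> b \<le> g2 * P2)
      \<or> (b \<le> g2 * P2 / (1 + g1 * P1) \<and> a \<le> g1 * P1)"
    and "g2 \<le> g1"
  shows "\<exists>Q1 Q2. 0 \<le> Q1 \<and> 0 \<le> Q2 \<and> Q1 + Q2 \<le> P1 + P2 \<and> a \<le> g1 * Q1 \<and> b \<le> g2 * Q2 / (1 + g2 * Q1)"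
proof (cases "g2 = 0")
  case True
  have "b = 0" using mac True assms by auto
  moreover have "a \<le> g1 * P1" using mac True by auto
  ultimately show ?thesis using True assms by (intro exI[of _ P1] exI[of _ 0]) auto
next
  case False
  then have g: "g1 > 0" "g2 > 0" using assms by auto
  define Q1 where "Q1 = a / g1"
  define Q2 where "Q2 = b * (1 + g2 * Q1) / g2"
  have "Q1 \<ge> 0" unfolding Q1_def using assms by simp
  then have "1 + g2 * Q1 > 0" using g by (simp add: add_pos_nonneg)
  then have "a \<le> g1 * Q1" "b \<le> g2 * Q2 / (1 + g2 * Q1)" "Q2 \<ge> 0"
    using g assms(2) by (simp_all add: Q1_def[abs_def] Q2_def)
  moreover have "Q1 + Q2 \<le> P1 + P2"
    using bc_power_le_mac_power[OF assms(1,2) g assms(5-8)] by (simp add: Q1_def Q2_def)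
  ultimately show ?thesis using \<open>Q1 \<ge> 0\<close> by blast
qed

text \<open>The slotwise form of the inclusion. For nonnegative gains the order of the gains is that
  of their squares, so either case is the power comparison, with the users swapped in the
  second.\<close>

lemma bc_transmittable_if_mac_transmittable:
  assumes mac: "mac_transmittable R P1max P2max h r" and R: "\<forall>r\<in>R. r \<ge> 0"
    and h: "fst h \<ge> 0" "snd h \<ge> 0"
  shows "bc_transmittable R (P1max + P2max) h r"
proof -
  define a b g1 g2 where "a = 2 powr fst r - 1" and "b = 2 powr snd r - 1"
    and "g1 = (fst h)\<^sup>2" and "g2 = (snd h)\<^sup>2"
  have r: "fst r \<in> R" "snd r \<in> R" using mac by (auto simp: mac_transmittable_def)
  have nonneg: "a \<ge> 0" "b \<ge> 0" "g1 \<ge> 0" "g2 \<ge> 0"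
    using r R by (auto simp: a_def b_def g1_def g2_def ge_one_powr_ge_zero)
  obtain P1 P2 where P: "0 \<le> P1" "P1 \<le> P1max" "0 \<le> P2" "P2 \<le> P2max"
    and *: "(fst r \<le> log 2 (1 + g1 * P1 / (1 + g2 * P2)) \<and> snd r \<le> log 2 (1 + g2 * P2)) \<or>
      (snd r \<le> log 2 (1 + g2 * P2 / (1 + g1 * P1)) \<and> fst r \<le> log 2 (1 + g1 * P1))"
    using mac unfolding mac_transmittable_def g1_def g2_def by blast
  have mac': "(a \<le> g1 * P1 / (1 + g2 * P2) \<and> b \<le> g2 * P2)
      \<or> (b \<le> g2 * P2 / (1 + g1 * P1) \<and> a \<le> g1 * P1)"
    using * P nonneg by (simp add: rate_le_log_iff a_def b_def)
  show ?thesis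
  proof (cases "fst h \<ge> snd h")
    case True
    then have "g2 \<le> g1" using h by (simp add: g1_def g2_def power_mono)
    from bc_allocation_exists[OF nonneg P(1,3) mac' this]
    obtain Q1 Q2 where Q: "0 \<le> Q1" "0 \<le> Q2" "Q1 + Q2 \<le> P1 + P2" "a \<le> g1 * Q1"
      "b \<le> g2 * Q2 / (1 + g2 * Q1)" by blast
    then have "fst r \<le> log 2 (1 + g1 * Q1)" "snd r \<le> log 2 (1 + g2 * Q2 / (1 + g2 * Q1))"
      using nonneg by (simp_all add: rate_le_log_iff a_def b_def)
    with Q P r True show ?thesis unfolding bc_transmittable_def g1_def g2_def
      by (intro conjI exI[of _ Q1] exI[of _ Q2]) auto
  next
    case False
    then have "g1 \<le> g2" using h by (simp add: g1_def g2_def power_mono)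
    \<comment> \<open>Swapping the users also exchanges the two decoding orders in
      \<open>mac'\<close>.\<close>
    from bc_allocation_exists[OF nonneg(2,1,4,3) P(3,1) _ this] mac'
    obtain Q1 Q2 where Q: "0 \<le> Q1" "0 \<le> Q2" "Q2 + Q1 \<le> P2 + P1" "b \<le> g2 * Q2"
      "a \<le> g1 * Q1 / (1 + g1 * Q2)" by blast
    then have "snd r \<le> log 2 (1 + g2 * Q2)" "fst r \<le> log 2 (1 + g1 * Q1 / (1 + g1 * Q2))"
      using nonneg by (simp_all add: rate_le_log_iff a_def b_def)
    with Q P r False show ?thesis unfolding bc_transmittable_def g1_def g2_def
      by (intro conjI exI[of _ Q1] exI[of _ Q2]) auto
  qed
qed

text \<open>Drops the interference and raises the power to its peak. This relaxation decouples the
  users and is all that the strictness argument takes from the MAC.\<close>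

lemma mac_transmittable_single_user_bounds:
  assumes "mac_transmittable R P1max P2max h r"
  shows "fst r \<le> log 2 (1 + (fst h)\<^sup>2 * P1max)" and "snd r \<le> log 2 (1 + (snd h)\<^sup>2 * P2max)"
proof -
  have le: "log 2 (1 + g * P / (1 + n)) \<le> log 2 (1 + g * Pmax)" "log 2 (1 + g * P) \<le> log 2 (1 + g * Pmax)"
    if "0 \<le> P" "P \<le> Pmax" "0 \<le> g" "0 \<le> n" for g P Pmax n :: real
  proof -
    have "g * P / (1 + n) \<le> g * P" using divide_left_mono[of 1 "1 + n" "g * P"] that by simp
    moreover have "g * P \<le> g * Pmax" using that by (simp add: mult_left_mono)
    moreover have "0 \<le> g * P / (1 + n)" using that by simp
    ultimately show "log 2 (1 + g * P / (1 + n)) \<le> log 2 (1 + g * Pmax)"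
      "log 2 (1 + g * P) \<le> log 2 (1 + g * Pmax)" by (auto intro!: log_mono)
  qed
  obtain P1 P2 where P: "0 \<le> P1" "P1 \<le> P1max" "0 \<le> P2" "P2 \<le> P2max"
    and *: "(fst r \<le> log 2 (1 + (fst h)\<^sup>2 * P1 / (1 + (snd h)\<^sup>2 * P2)) \<and> snd r \<le> log 2 (1 + (snd h)\<^sup>2 * P2)) \<or>
      (snd r \<le> log 2 (1 + (snd h)\<^sup>2 * P2 / (1 + (fst h)\<^sup>2 * P1)) \<and> fst r \<le> log 2 (1 + (fst h)\<^sup>2 * P1))"
    using assms unfolding mac_transmittable_def by blast
  show "fst r \<le> log 2 (1 + (fst h)\<^sup>2 * P1max)"
    using * le[OF P(1,2), of "(fst h)\<^sup>2" "(snd h)\<^sup>2 * P2"] P by auto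
  show "snd r \<le> log 2 (1 + (snd h)\<^sup>2 * P2max)"
    using * le[OF P(3,4), of "(snd h)\<^sup>2" "(fst h)\<^sup>2 * P1"] P by auto
qed

text \<open>Rates that cannot be decoded are replaced by 0 instead of being removed. The maximum
  then runs over a fixed finite index set, which makes it measurable in \<open>s\<close>.\<close>

definition max_rate :: "real set \<Rightarrow> real \<Rightarrow> real" where
  "max_rate R s = Max ((\<lambda>r. if r \<le> log 2 (1 + s) then r else 0) ` R)"

lemma max_rate_in:
  assumes "finite R" "0 \<in> R" shows "max_rate R s \<in> R"
proof -
  have "max_rate R s \<in> (\<lambda>r. if r \<le> log 2 (1 + s) then r else 0) ` R"
    unfolding max_rate_def using assms by (intro Max_in) auto
  then show ?thesis using assms by auto
qed

lemma max_rate_le_log: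
  assumes "finite R" "0 \<in> R" "s \<ge> 0" shows "max_rate R s \<le> log 2 (1 + s)"
proof -
  have "max_rate R s \<in> (\<lambda>r. if r \<le> log 2 (1 + s) then r else 0) ` R"
    unfolding max_rate_def using assms by (intro Max_in) auto
  then show ?thesis using assms by auto
qed

lemma max_rate_ge: "finite R \<Longrightarrow> r \<in> R \<Longrightarrow> r \<le> log 2 (1 + s) \<Longrightarrow> r \<le> max_rate R s"
  unfolding max_rate_def by (intro Max_ge) (auto intro!: image_eqI[of _ _ r])

lemma max_rate_measurable:
  assumes [simp]: "finite R" and [measurable]: "f \<in> borel_measurable M"
  shows "(\<lambda>x. max_rate R (f x)) \<in> borel_measurable M"
  unfolding max_rate_def by measurable

section \<open>BC slots that serve a single user\<close>

lemma bc_transmittable_first_user: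
  assumes "finite R" "0 \<in> R" "P \<ge> 0"
  shows "bc_transmittable R P h (max_rate R ((fst h)\<^sup>2 * P), 0)"
proof -
  have "max_rate R ((fst h)\<^sup>2 * P) \<le> log 2 (1 + (fst h)\<^sup>2 * P)"
    using assms by (intro max_rate_le_log) auto
  then show ?thesis unfolding bc_transmittable_def
    using assms max_rate_in[OF assms(1,2)] by (intro conjI exI[of _ P] exI[of _ 0]) auto
qed

lemma bc_transmittable_second_user:
  assumes "0 \<in> R" "r \<in> R" "P \<ge> 0" "r \<le> log 2 (1 + (snd h)\<^sup>2 * P)"
  shows "bc_transmittable R P h (0, r)"
  unfolding bc_transmittable_def
  using assms by (intro conjI exI[of _ 0] exI[of _ P]) auto

section \<open>Stability regions\<close>

lemma snth_eq_if_stake_eq: "stake (Suc t) \<omega> = stake (Suc t) \<omega>' \<Longrightarrow> \<omega> !! t = \<omega>' !! t"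
  using stake_nth[of t "Suc t" \<omega>] stake_nth[of t "Suc t" \<omega>'] by simp

locale fading_process = ergodic_system \<mu> stl for \<mu> :: "(real \<times> real) stream measure" +
  assumes sets_eq [measurable_cong]: "sets \<mu> = sets (stream_space borel)"
begin

lemma space_eq: "space \<mu> = UNIV"
  using sets_eq_imp_space_eq[OF sets_eq] by (simp add: space_stream_space)

lemma snth_measurable [measurable]: "(\<lambda>\<omega>. \<omega> !! t) \<in> borel_measurable \<mu>"
  using measurable_snth[of t borel] measurable_cong_sets[OF sets_eq refl] by blast

lemma shd_measurable [measurable]: "shd \<in> borel_measurable \<mu>"
  using measurable_shd[of borel] measurable_cong_sets[OF sets_eq refl] by blast

lemma gain_measurable [measurable]:
  "(\<lambda>\<omega>. fst (\<omega> !! t)) \<in> borel_measurable \<mu>" "(\<lambda>\<omega>. snd (\<omega> !! t)) \<in> borel_measurable \<mu>"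
  by (rule measurable_compose[OF snth_measurable borel_measurable_continuous_onI],
      simp add: continuous_on_fst continuous_on_snd)+

lemma stl_funpow: "(stl ^^ n) \<omega> = sdrop n \<omega>" for \<omega> :: "'b stream"
  by (induction n arbitrary: \<omega>) (simp_all add: funpow_Suc_right del: funpow.simps(2))

lemma shd_funpow: "shd ((stl ^^ n) \<omega>) = \<omega> !! n" for \<omega> :: "'b stream"
  by (simp add: stl_funpow)

text \<open>Confines the region to a closed half-space, so only achievable vectors have to be
  checked and the closure follows. It is applied below with \<open>fst\<close> and
  \<open>snd\<close> as \<open>F\<close>.\<close>

lemma stability_region_bounded_linear_le:
  fixes F :: "real \<times> real \<Rightarrow> real" and G :: "real \<times> real \<Rightarrow> real"
  assumes F: "bounded_linear F" and G [measurable]: "G \<in> borel_measurable borel"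
    and G_bound: "\<And>h. \<bar>G h\<bar> \<le> B"
    and feas: "\<And>h r. feas h r \<Longrightarrow> \<bar>F r\<bar> \<le> B" "\<And>h r. feas h r \<Longrightarrow> F r \<le> G h"
    and d: "d \<in> stability_region \<mu> feas"
  shows "F d \<le> (\<integral>\<omega>. G (shd \<omega>) \<partial>\<mu>)"
proof -
  interpret F: bounded_linear F by fact
  note F_borel [measurable] = borel_measurable_continuous_onI[OF F.continuous_on[OF continuous_on_id]]
  let ?I = "\<integral>\<omega>. G (shd \<omega>) \<partial>\<mu>"
  let ?S = "{d. F d \<le> ?I}"
  have "closed ?S" by (intro closed_Collect_le F.continuous_on continuous_intros)
  moreover have "F d \<le> ?I" if \<pi>: "causal_policy \<mu> \<pi>" "\<forall>t \<omega>. feas (\<omega> !! t) (\<pi> t \<omega>)"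
    and lim: "AE \<omega> in \<mu>. (\<lambda>T. inverse (real T) *\<^sub>R (\<Sum>t<T. \<pi> t \<omega>)) \<longlonglongrightarrow> d" for \<pi> d
  proof (rule average_limit_le_integral[where B = B and f = "\<lambda>t \<omega>. F (\<pi> t \<omega>)"])
    have [measurable]: "\<pi> t \<in> borel_measurable \<mu>" for t
      using \<pi>(1) by (simp add: causal_policy_def)
    show "(\<lambda>\<omega>. F (\<pi> t \<omega>)) \<in> borel_measurable \<mu>" for t by measurable
    show "(\<lambda>\<omega>. G (shd \<omega>)) \<in> borel_measurable \<mu>" by measurable
    show "\<bar>F (\<pi> t \<omega>)\<bar> \<le> B" for t \<omega> using \<pi>(2) feas(1) by blast
    show "\<bar>G (shd \<omega>)\<bar> \<le> B" for \<omega> by (rule G_bound)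
    show "F (\<pi> t \<omega>) \<le> G (shd ((stl ^^ t) \<omega>))" for t \<omega>
      using \<pi>(2) feas(2) by (simp add: shd_funpow)
    show "AE \<omega> in \<mu>. (\<lambda>n. (\<Sum>t<n. F (\<pi> t \<omega>)) / n) \<longlonglongrightarrow> F d"
      using lim
    proof eventually_elim
      case (elim \<omega>)
      from F.tendsto[OF this] show ?case
        by (simp add: F.scaleR F.sum divide_inverse mult.commute)
    qed
  qed
  ultimately have "stability_region \<mu> feas \<subseteq> ?S"
    unfolding stability_region_def by (intro closure_minimal) auto
  with d show ?thesis by blast
qed

text \<open>A policy that reads only the current gains yields averages along the shift orbit, so
  Birkhoff's theorem in each coordinate attains this vector even before taking the closure.\<close>

lemma state_policy_in_stability_region:
  fixes \<phi> :: "real \<times> real \<Rightarrow> real \<times> real"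
  assumes [measurable]: "(\<lambda>h. fst (\<phi> h)) \<in> borel_measurable borel"
      "(\<lambda>h. snd (\<phi> h)) \<in> borel_measurable borel"
    and bounded: "\<And>h. \<bar>fst (\<phi> h)\<bar> \<le> B" "\<And>h. \<bar>snd (\<phi> h)\<bar> \<le> B"
    and feas: "\<And>h. feas h (\<phi> h)"
  shows "((\<integral>\<omega>. fst (\<phi> (shd \<omega>)) \<partial>\<mu>), (\<integral>\<omega>. snd (\<phi> (shd \<omega>)) \<partial>\<mu>)) \<in> stability_region \<mu> feas"
    (is "(?d1, ?d2) \<in> _")
proof -
  define \<pi> where "\<pi> t \<omega> = \<phi> (\<omega> !! t)" for t and \<omega> :: "(real \<times> real) stream"
  have [measurable]: "\<phi> \<in> borel_measurable borel"
    using borel_measurable_Pair[OF assms(1,2)] by simp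
  have \<pi>_meas: "\<pi> t \<in> borel_measurable \<mu>" for t
    unfolding \<pi>_def[abs_def] by measurable
  have "\<pi> t \<omega> = \<pi> t \<omega>'" if "stake (Suc t) \<omega> = stake (Suc t) \<omega>'" for t \<omega> \<omega>'
    using snth_eq_if_stake_eq[OF that] by (simp add: \<pi>_def)
  with \<pi>_meas have "causal_policy \<mu> \<pi>"
    unfolding causal_policy_def by blast
  moreover have "AE \<omega> in \<mu>. (\<lambda>T. inverse (real T) *\<^sub>R (\<Sum>t<T. \<pi> t \<omega>)) \<longlonglongrightarrow> (?d1, ?d2)"
  proof -
    have "AE \<omega> in \<mu>. (\<lambda>n. (\<Sum>k<n. fst (\<phi> (shd ((stl ^^ k) \<omega>)))) / n) \<longlonglongrightarrow> ?d1"
      by (rule birkhoff_bounded[where B = B and f = "\<lambda>\<omega>. fst (\<phi> (shd \<omega>))"])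
         (use measurable_compose[OF shd_measurable assms(1)] bounded in auto)
    moreover have "AE \<omega> in \<mu>. (\<lambda>n. (\<Sum>k<n. snd (\<phi> (shd ((stl ^^ k) \<omega>)))) / n) \<longlonglongrightarrow> ?d2"
      by (rule birkhoff_bounded[where B = B and f = "\<lambda>\<omega>. snd (\<phi> (shd \<omega>))"])
         (use measurable_compose[OF shd_measurable assms(2)] bounded in auto)
    ultimately show ?thesis
    proof eventually_elim
      case (elim \<omega>)
      have "inverse (real n) *\<^sub>R (\<Sum>t<n. \<pi> t \<omega>)
          = ((\<Sum>k<n. fst (\<phi> (shd ((stl ^^ k) \<omega>)))) / n, (\<Sum>k<n. snd (\<phi> (shd ((stl ^^ k) \<omega>)))) / n)" for n
        by (rule prod_eqI) (simp_all add: shd_funpow \<pi>_def fst_sum snd_sum divide_inverse mult.commute)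
      then show ?case using tendsto_Pair[OF elim] by simp
    qed
  qed
  ultimately show ?thesis
    unfolding stability_region_def using feas
    by (intro subsetD[OF closure_subset] CollectI exI[of _ \<pi>]) (auto simp: \<pi>_def)
qed

text \<open>Gains that are negative with probability zero may violate the hypothesis on the
  feasibility predicates; there the dominating policy stays silent.\<close>

lemma stability_region_mono_AE:
  assumes le: "\<And>h r. 0 \<le> fst h \<Longrightarrow> 0 \<le> snd h \<Longrightarrow> feas h r \<Longrightarrow> feas' h r"
    and zero: "\<And>h. feas' h (0, 0)"
    and nonneg: "AE \<omega> in \<mu>. 0 \<le> fst (shd \<omega>)" "AE \<omega> in \<mu>. 0 \<le> snd (shd \<omega>)"
  shows "stability_region \<mu> feas \<subseteq> stability_region \<mu> feas'"
  unfolding stability_region_def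
proof (intro closure_mono subsetI CollectI, elim CollectE exE conjE)
  fix d \<pi>
  assume \<pi>: "causal_policy \<mu> \<pi>" "\<forall>t \<omega>. feas (\<omega> !! t) (\<pi> t \<omega>)"
    and lim: "AE \<omega> in \<mu>. (\<lambda>T. inverse (real T) *\<^sub>R (\<Sum>t<T. \<pi> t \<omega>)) \<longlonglongrightarrow> d"
  define \<pi>' where "\<pi>' t \<omega> = (if 0 \<le> fst (\<omega> !! t) \<and> 0 \<le> snd (\<omega> !! t) then \<pi> t \<omega> else (0, 0))" for t \<omega>
  have [measurable]: "\<pi> t \<in> borel_measurable \<mu>" for t
    using \<pi>(1) by (simp add: causal_policy_def)
  have \<pi>'_meas: "\<pi>' t \<in> borel_measurable \<mu>" for t
    unfolding \<pi>'_def[abs_def] by measurable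
  have "\<pi>' t \<omega> = \<pi>' t \<omega>'" if eq: "stake (Suc t) \<omega> = stake (Suc t) \<omega>'" for t \<omega> \<omega>'
  proof -
    have "\<pi> t \<omega> = \<pi> t \<omega>'" using \<pi>(1) eq unfolding causal_policy_def by blast
    then show ?thesis using snth_eq_if_stake_eq[OF eq] by (simp add: \<pi>'_def)
  qed
  with \<pi>'_meas have "causal_policy \<mu> \<pi>'"
    unfolding causal_policy_def by blast
  moreover have "\<forall>t \<omega>. feas' (\<omega> !! t) (\<pi>' t \<omega>)"
    using \<pi>(2) le zero by (auto simp: \<pi>'_def)
  \<comment> \<open>Each slot contributes one null set by stationarity, and there are countably many
    slots.\<close>
  moreover have "AE \<omega> in \<mu>. \<forall>t. 0 \<le> fst (\<omega> !! t) \<and> 0 \<le> snd (\<omega> !! t)"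
    unfolding AE_all_countable
  proof
    fix t
    have "AE \<omega> in \<mu>. 0 \<le> fst (shd \<omega>) \<and> 0 \<le> snd (shd \<omega>)" using nonneg by eventually_elim simp
    from AE_funpow[OF this, of t]
    show "AE \<omega> in \<mu>. 0 \<le> fst (\<omega> !! t) \<and> 0 \<le> snd (\<omega> !! t)" by (simp add: shd_funpow)
  qed
  then have "AE \<omega> in \<mu>. (\<lambda>T. inverse (real T) *\<^sub>R (\<Sum>t<T. \<pi>' t \<omega>)) \<longlonglongrightarrow> d"
    using lim by eventually_elim (simp add: \<pi>'_def)
  ultimately show "\<exists>\<pi>. causal_policy \<mu> \<pi> \<and> (\<forall>t \<omega>. feas' (\<omega> !! t) (\<pi> t \<omega>)) \<and>
      (AE \<omega> in \<mu>. (\<lambda>T. inverse (real T) *\<^sub>R (\<Sum>t<T. \<pi> t \<omega>)) \<longlonglongrightarrow> d)"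
    by blast
qed

end

section \<open>Separation near the single-user corner\<close>

text \<open>For nonnegative gains the event is \<open>sqrt (a / P) \<le> X\<close>; negative gains
  have probability zero, so the two events agree almost everywhere.\<close>

lemma (in prob_space) rayleigh_prob_gain_ge:
  assumes [measurable]: "random_variable borel X"
    and "distr M borel X = density lborel (rayleigh_density \<sigma>)" and "\<sigma> > 0" and "a \<ge> 0" and "P > 0"
  shows "prob {\<omega> \<in> space M. a \<le> (X \<omega>)\<^sup>2 * P} = exp (- a / (2 * \<sigma>\<^sup>2 * P))"
proof -
  have "prob {\<omega> \<in> space M. a \<le> (X \<omega>)\<^sup>2 * P} = prob {\<omega> \<in> space M. sqrt (a / P) \<le> X \<omega>}"
  proof (rule finite_measure_eq_AE)
    show "AE \<omega> in M. (\<omega> \<in> {\<omega> \<in> space M. a \<le> (X \<omega>)\<^sup>2 * P}) = (\<omega> \<in> {\<omega> \<in> space M. sqrt (a / P) \<le> X \<omega>})"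
      using rayleigh_AE_nonneg[OF assms(1-3)]
    proof eventually_elim
      case (elim \<omega>)
      have "sqrt (a / P) \<le> X \<omega> \<longleftrightarrow> (sqrt (a / P))\<^sup>2 \<le> (X \<omega>)\<^sup>2"
        using elim assms by (intro power_mono_iff[symmetric]) auto
      also have "\<dots> \<longleftrightarrow> a \<le> (X \<omega>)\<^sup>2 * P"
        using assms by (simp add: pos_divide_le_eq)
      finally show ?case by simp
    qed
  qed auto
  then show ?thesis
    using rayleigh_prob_atLeast[OF assms(1-3), of "sqrt (a / P)"] assms by (simp add: mult.commute mult.left_commute)
qed

text \<open>Makes the probability of a narrow band of gains at least linear in its relative width
  \<open>u\<close>. It rests on \<open>1 - exp (- v) \<ge> v / (1 + v)\<close> for
  \<open>v = \<alpha> * u\<close>.\<close>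

lemma exp_decrement_ge:
  fixes \<alpha> u :: real
  assumes "\<alpha> > 0" "0 \<le> u" "u \<le> 1"
  shows "exp (- \<alpha>) * \<alpha> / (1 + \<alpha>) * u \<le> exp (- \<alpha>) - exp (- (\<alpha> * (1 + u)))"
proof -
  have "exp (- (\<alpha> * u)) \<le> 1 / (1 + \<alpha> * u)"
    using exp_ge_add_one_self[of "\<alpha> * u"] assms
    by (simp add: exp_minus divide_simps add_pos_nonneg)
  then have "1 - exp (- (\<alpha> * u)) \<ge> \<alpha> * u / (1 + \<alpha> * u)"
  proof -
    have "1 + \<alpha> * u > 0" using assms by (simp add: add_pos_nonneg)
    then have "1 - 1 / (1 + \<alpha> * u) = \<alpha> * u / (1 + \<alpha> * u)" by (simp add: field_simps)
    then show ?thesis using \<open>exp (- (\<alpha> * u)) \<le> 1 / (1 + \<alpha> * u)\<close> by linarith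
  qed
  moreover have "\<alpha> * u / (1 + \<alpha>) \<le> \<alpha> * u / (1 + \<alpha> * u)"
    using assms by (intro divide_left_mono) (auto simp: add_pos_nonneg mult_left_le)
  ultimately have "\<alpha> * u / (1 + \<alpha>) \<le> 1 - exp (- (\<alpha> * u))" by linarith
  then have "exp (- \<alpha>) * (\<alpha> * u / (1 + \<alpha>)) \<le> exp (- \<alpha>) * (1 - exp (- (\<alpha> * u)))"
    by (intro mult_left_mono) auto
  also have "\<dots> = exp (- \<alpha>) - exp (- (\<alpha> * (1 + u)))"
    by (simp add: algebra_simps flip: exp_add)
  finally show ?thesis by (simp add: algebra_simps)
qed

text \<open>The cost forces \<open>u\<close> to be at most of order \<open>p\<close>, while the gain
  forces \<open>p\<close> to be at most of order \<open>u\<^sup>2\<close>, since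
  \<open>exp (- \<beta> / u) \<le> 2 * u\<^sup>2 / \<beta>\<^sup>2\<close>. Eliminating
  \<open>u\<close> and cancelling one factor \<open>p\<close> bounds \<open>p\<close> from below
  independently of \<open>u\<close>.\<close>

lemma corner_exchange_bound:
  fixes r c \<beta> u p m :: real
  assumes pos: "r > 0" "c > 0" "\<beta> > 0" "u > 0" "p > 0" "m \<ge> 0"
    and cost: "r * (c * u) \<le> m * p" and gain: "r * p \<le> m * exp (- \<beta> / u)"
  shows "\<beta>\<^sup>2 * r ^ 3 * c\<^sup>2 \<le> 2 * m ^ 3 * p"
proof -
  have "(\<beta> / u)\<^sup>2 / 2 \<le> exp (\<beta> / u)"
  proof -
    have "0 \<le> \<beta> / u" using pos by simp
    with exp_lower_Taylor_quadratic[OF this] show ?thesis by linarith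
  qed
  then have "exp (- \<beta> / u) * \<beta>\<^sup>2 \<le> 2 * u\<^sup>2"
    using pos by (simp add: exp_minus field_simps)
  then have "m * (exp (- \<beta> / u) * \<beta>\<^sup>2) \<le> m * (2 * u\<^sup>2)"
    using pos by (intro mult_left_mono) auto
  moreover have "r * p * \<beta>\<^sup>2 \<le> m * exp (- \<beta> / u) * \<beta>\<^sup>2"
    using gain by (intro mult_right_mono) auto
  ultimately have "r * p * \<beta>\<^sup>2 \<le> 2 * m * u\<^sup>2" by (simp add: algebra_simps)
  then have "(r * p * \<beta>\<^sup>2) * (r * c)\<^sup>2 \<le> (2 * m * u\<^sup>2) * (r * c)\<^sup>2"
    by (intro mult_right_mono) auto
  also have "\<dots> = 2 * m * (r * (c * u))\<^sup>2" by (simp add: power2_eq_square algebra_simps)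
  also have "\<dots> \<le> 2 * m * (m * p)\<^sup>2"
    using pos cost by (intro mult_left_mono power_mono) auto
  finally have "(\<beta>\<^sup>2 * r ^ 3 * c\<^sup>2) * p \<le> (2 * m ^ 3 * p) * p"
    by (simp add: power2_eq_square power3_eq_cube algebra_simps)
  then show ?thesis using pos by simp
qed

theorem theorem2:
  fixes \<mu> :: "(real \<times> real) stream measure" and R :: "real set"
    and Ptot \<sigma>1 \<sigma>2 :: real
  assumes "prob_space \<mu>" and "sets \<mu> = sets (stream_space borel)"
    and "stationary_ergodic \<mu>"
    and "\<sigma>1 > 0" and "\<sigma>2 > 0"
    and "distr \<mu> borel (\<lambda>\<omega>. fst (shd \<omega>)) = density lborel (rayleigh_density \<sigma>1)"
    and "distr \<mu> borel (\<lambda>\<omega>. snd (shd \<omega>)) = density lborel (rayleigh_density \<sigma>2)"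
    and "finite R" and "0 \<in> R" and "\<forall>r\<in>R. r \<ge> 0" and "\<exists>r\<in>R. r > 0"
    and "Ptot > 0"
  shows "(\<Union>(P1, P2) \<in> {(P1, P2). P1 \<ge> 0 \<and> P2 \<ge> 0 \<and> P1 + P2 = Ptot}.
            stability_region \<mu> (mac_transmittable R P1 P2))
         \<subset> stability_region \<mu> (bc_transmittable R Ptot)"
proof -
  interpret ergodic_system \<mu> stl by (rule stationary_ergodic_system) fact+
  interpret fading_process \<mu> by unfold_locales fact
  note \<sigma> = assms(4,5) and R = assms(8-11) and Ptot = \<open>Ptot > 0\<close>
  define h1 h2 where "h1 \<omega> = fst (shd \<omega>)" and "h2 \<omega> = snd (shd \<omega>)"
    for \<omega> :: "(real \<times> real) stream"
  have h_meas [measurable]: "h1 \<in> borel_measurable \<mu>" "h2 \<in> borel_measurable \<mu>"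
    using gain_measurable[of 0] by (simp_all add: h1_def[abs_def] h2_def[abs_def])
  have distr: "distr \<mu> borel h1 = density lborel (rayleigh_density \<sigma>1)"
      "distr \<mu> borel h2 = density lborel (rayleigh_density \<sigma>2)"
    using assms(6,7) by (simp_all add: h1_def[abs_def] h2_def[abs_def])
  \<comment> \<open>The smallest positive codebook rate. A user whose signal-to-noise ratio stays
    below its threshold \<open>a\<close> must be silent.\<close>
  define r where "r = Min {r\<in>R. r > 0}"
  have r_in: "r \<in> {r\<in>R. r > 0}" unfolding r_def using R by (intro Min_in) auto
  then have r: "r \<in> R" "r > 0" by auto
  have r_least: "r \<le> r'" if "r' \<in> R" "r' > 0" for r'
    unfolding r_def using R that by (intro Min_le) auto
  define m where "m = Max R"
  have m: "r' \<le> m" if "r' \<in> R" for r' unfolding m_def using R that by simp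
  have m_pos: "m > 0" using m[OF r(1)] r by simp
  define a where "a = 2 powr r - 1"
  have a: "a > 0" using r by (simp add: a_def)
  have r_le_iff: "r \<le> log 2 (1 + s) \<longleftrightarrow> a \<le> s" if "s \<ge> 0" for s
    unfolding a_def by (rule rate_le_log_iff[OF that])
  have r_less_iff: "r' = 0" if "r' \<in> R" "r' \<le> log 2 (1 + s)" "0 \<le> s" "s < a" for r' s
    using that r_least[of r'] r_le_iff[of s] R by force
  \<comment> \<open>At full power the two users reach \<open>a\<close> with probabilities
    \<open>exp (- \<alpha>)\<close> and \<open>exp (- \<beta>)\<close>; a fraction \<open>u\<close>
    of it turns the latter into \<open>exp (- \<beta> / u)\<close>. The constant \<open>c\<close> is
    the slope in \<open>exp_decrement_ge\<close>.\<close>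
  define \<alpha> \<beta> c where "\<alpha> = a / (2 * \<sigma>1\<^sup>2 * Ptot)" and "\<beta> = a / (2 * \<sigma>2\<^sup>2 * Ptot)"
    and "c = exp (- \<alpha>) * \<alpha> / (1 + \<alpha>)"
  have pos: "\<alpha> > 0" "\<beta> > 0" "c > 0"
  proof -
    show "\<alpha> > 0" "\<beta> > 0" using \<sigma> a Ptot by (simp_all add: \<alpha>_def \<beta>_def)
    then show "c > 0" by (simp add: c_def)
  qed
  \<comment> \<open>Rate of the first user when served alone at full power; its mean is the corner
    from which the BC deviates.\<close>
  define f where "f h = max_rate R ((fst h)\<^sup>2 * Ptot)" for h :: "real \<times> real"
  have fst_borel [measurable]: "fst \<in> borel_measurable (borel :: (real \<times> real) measure)"
    and snd_borel [measurable]: "snd \<in> borel_measurable (borel :: (real \<times> real) measure)"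
    by (simp_all add: borel_measurable_continuous_onI continuous_on_fst continuous_on_snd)
  have f_meas [measurable]: "f \<in> borel_measurable borel"
    unfolding f_def[abs_def] by (intro max_rate_measurable R) measurable
  have f_in: "f h \<in> R" for h unfolding f_def using R by (intro max_rate_in)
  have f_bound: "0 \<le> f h" "f h \<le> m" for h using f_in R m by auto

  \<comment> \<open>The lower bound on \<open>p\<close> that \<open>corner_exchange_bound\<close>
    will impose on any MAC; \<open>p\<close> is chosen below it, independently of the power
    split.\<close>
  define q where "q = \<beta>\<^sup>2 * r ^ 3 * c\<^sup>2 / (2 * m ^ 3)"
  have "q > 0" using pos r m_pos by (simp add: q_def)
  have "((\<lambda>K. exp (- K\<^sup>2 / (2 * \<sigma>2\<^sup>2))) \<longlongrightarrow> 0) at_top"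
    using \<sigma> by real_asymp
  then have "eventually (\<lambda>K. exp (- K\<^sup>2 / (2 * \<sigma>2\<^sup>2)) < q) at_top"
    using \<open>q > 0\<close> by (rule order_tendstoD)
  moreover have "eventually (\<lambda>K. K \<ge> sqrt (a / Ptot)) at_top" by (rule eventually_ge_at_top)
  ultimately have "eventually (\<lambda>K. exp (- K\<^sup>2 / (2 * \<sigma>2\<^sup>2)) < q \<and> K \<ge> sqrt (a / Ptot)) at_top"
    by (rule eventually_conj)
  \<comment> \<open>The first condition makes serving the second user rarer than \<open>q\<close>;
    the second lets that user decode \<open>r\<close> at full power whenever its gain is at least
    \<open>K\<close>.\<close>
  then obtain K where K: "exp (- K\<^sup>2 / (2 * \<sigma>2\<^sup>2)) < q" "sqrt (a / Ptot) \<le> K"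
    by (auto simp: eventually_at_top_linorder)
  have K_nonneg: "0 \<le> K" using K(2) a Ptot by (smt (verit) divide_nonneg_pos real_sqrt_ge_zero)
  define p where "p = prob {\<omega> \<in> space \<mu>. K \<le> h2 \<omega>}"
  have p_eq: "p = exp (- K\<^sup>2 / (2 * \<sigma>2\<^sup>2))"
    unfolding p_def by (rule rayleigh_prob_atLeast[OF h_meas(2) distr(2) \<sigma>(2) K_nonneg])
  have p: "0 < p" "p < q" using K by (simp_all add: p_eq)
  have strong: "r \<le> log 2 (1 + x\<^sup>2 * Ptot)" if "K \<le> x" for x
  proof -
    have "(sqrt (a / Ptot))\<^sup>2 \<le> x\<^sup>2" using K(2) that a Ptot by (intro power_mono) auto
    then have "a \<le> x\<^sup>2 * Ptot" using a Ptot by (simp add: pos_divide_le_eq)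
    then show ?thesis using Ptot by (simp add: r_le_iff)
  qed

  define \<phi> where "\<phi> h = (if K \<le> snd h then (0, r) else (f h, 0))" for h
  define d where "d = ((\<integral>\<omega>. fst (\<phi> (shd \<omega>)) \<partial>\<mu>), (\<integral>\<omega>. snd (\<phi> (shd \<omega>)) \<partial>\<mu>))"
  have d_bc: "d \<in> stability_region \<mu> (bc_transmittable R Ptot)"
    unfolding d_def
  proof (rule state_policy_in_stability_region[where B = m])
    have "(\<lambda>h. fst (\<phi> h)) = (\<lambda>h. if K \<le> snd h then 0 else f h)"
      "(\<lambda>h. snd (\<phi> h)) = (\<lambda>h. if K \<le> snd h then r else 0)" by (auto simp: \<phi>_def)
    then show "(\<lambda>h. fst (\<phi> h)) \<in> borel_measurable borel" "(\<lambda>h. snd (\<phi> h)) \<in> borel_measurable borel"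
      by simp_all
    show "\<bar>fst (\<phi> h)\<bar> \<le> m" "\<bar>snd (\<phi> h)\<bar> \<le> m" for h
      using f_bound[of h] m_pos m[OF r(1)] r by (auto simp: \<phi>_def)
    show "bc_transmittable R Ptot h (\<phi> h)" for h
      unfolding \<phi>_def f_def
      using bc_transmittable_second_user[OF R(2) r(1), of Ptot h] strong[of "snd h"]
        bc_transmittable_first_user[OF R(1,2), of Ptot h] Ptot by auto
  qed
  have f_shd_meas [measurable]: "(\<lambda>\<omega>. f (shd \<omega>)) \<in> borel_measurable \<mu>"
    by (rule measurable_compose[OF shd_measurable f_meas])
  have f_int: "integrable \<mu> (\<lambda>\<omega>. f (shd \<omega>))"
    by (rule integrable_const_bound[where B = m]) (auto simp: f_bound)
  have diff_int: "integrable \<mu> (\<lambda>\<omega>. f (shd \<omega>) - k * indicator A \<omega>)"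
      "(\<integral>\<omega>. f (shd \<omega>) - k * indicator A \<omega> \<partial>\<mu>) = (\<integral>\<omega>. f (shd \<omega>) \<partial>\<mu>) - k * prob A"
    if "A \<in> sets \<mu>" for k A
  proof -
    have "integrable \<mu> (\<lambda>\<omega>. k * indicator A \<omega>)"
      using that by (intro integrable_mult_right integrable_real_indicator) (auto simp: less_top[symmetric])
    with f_int that show "integrable \<mu> (\<lambda>\<omega>. f (shd \<omega>) - k * indicator A \<omega>)"
      "(\<integral>\<omega>. f (shd \<omega>) - k * indicator A \<omega> \<partial>\<mu>) = (\<integral>\<omega>. f (shd \<omega>) \<partial>\<mu>) - k * prob A"
      by (simp_all add: Bochner_Integration.integral_diff)
  qed
  \<comment> \<open>The first user is switched off on an event of probability \<open>p\<close> and
    loses at most \<open>m\<close> there.\<close>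
  have d_fst: "(\<integral>\<omega>. f (shd \<omega>) \<partial>\<mu>) - m * p \<le> fst d"
  proof -
    let ?A = "{\<omega> \<in> space \<mu>. K \<le> h2 \<omega>}"
    have "(\<integral>\<omega>. f (shd \<omega>) \<partial>\<mu>) - m * p = (\<integral>\<omega>. f (shd \<omega>) - m * indicator ?A \<omega> \<partial>\<mu>)"
      by (simp add: diff_int p_def)
    also have "\<dots> \<le> (\<integral>\<omega>. (if K \<le> h2 \<omega> then 0 else f (shd \<omega>)) \<partial>\<mu>)"
    proof (rule integral_mono)
      show "integrable \<mu> (\<lambda>\<omega>. f (shd \<omega>) - m * indicator ?A \<omega>)" by (rule diff_int) measurable
      show "integrable \<mu> (\<lambda>\<omega>. if K \<le> h2 \<omega> then 0 else f (shd \<omega>))"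
        by (rule integrable_const_bound[where B = m]) (use m_pos in \<open>auto simp: f_bound\<close>)
      show "f (shd \<omega>) - m * indicator ?A \<omega> \<le> (if K \<le> h2 \<omega> then 0 else f (shd \<omega>))"
        if "\<omega> \<in> space \<mu>" for \<omega> using that f_bound by (auto simp: indicator_def)
    qed
    also have "\<dots> = fst d"
      unfolding d_def by (auto simp: \<phi>_def h2_def intro!: Bochner_Integration.integral_cong)
    finally show ?thesis .
  qed
  have d_snd: "snd d = r * p"
  proof -
    have "snd d = (\<integral>\<omega>. r * indicator {\<omega> \<in> space \<mu>. K \<le> h2 \<omega>} \<omega> \<partial>\<mu>)"
      unfolding d_def snd_conv
      by (rule Bochner_Integration.integral_cong) (auto simp: \<phi>_def h2_def indicator_def)
    then show ?thesis by (simp add: p_def)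
  qed

  have "d \<notin> stability_region \<mu> (mac_transmittable R P1 P2)"
    if P: "P1 \<ge> 0" "P2 \<ge> 0" "P1 + P2 = Ptot" for P1 P2
  proof
    assume d: "d \<in> stability_region \<mu> (mac_transmittable R P1 P2)"
    have mac_in: "fst s \<in> R" "snd s \<in> R" if "mac_transmittable R P1 P2 h s" for h s
      using that by (simp_all add: mac_transmittable_def)
    have mac_bound: "\<bar>fst s\<bar> \<le> m" "\<bar>snd s\<bar> \<le> m" if "mac_transmittable R P1 P2 h s" for h s
      using mac_in[OF that] R m by auto
    define u where "u = P2 / Ptot"
    have u: "0 \<le> u" "u \<le> 1" and P2: "P2 = Ptot * u" and P1: "P1 = Ptot * (1 - u)"
      using P Ptot by (auto simp: u_def field_simps)
    \<comment> \<open>For gains in \<open>[x, y)\<close> full power reaches \<open>a\<close>, by a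
      factor below \<open>1 + u\<close>. The MAC power is smaller by the factor
      \<open>1 - u\<close>, and \<open>(1 + u) * (1 - u) \<le> 1\<close>, so the first MAC user
      falls short of \<open>a\<close>.\<close>
    define x y where "x = sqrt (a / Ptot)" and "y = sqrt (a * (1 + u) / Ptot)"
    have xy: "0 \<le> x" "x \<le> y"
      using a u Ptot by (auto simp: x_def y_def divide_right_mono)
    have x2: "x\<^sup>2 = a / Ptot" and y2: "y\<^sup>2 = a * (1 + u) / Ptot"
      using a u Ptot by (simp_all add: x_def y_def)
    let ?A = "{\<omega> \<in> space \<mu>. x \<le> h1 \<omega> \<and> h1 \<omega> < y}"
    have "prob ?A = exp (- \<alpha>) - exp (- (\<alpha> * (1 + u)))"
      using rayleigh_prob_atLeastLessThan[OF h_meas(1) distr(1) \<sigma>(1) xy]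
      by (simp add: x2 y2 \<alpha>_def mult.commute mult.left_commute)
    with exp_decrement_ge[OF pos(1) u] have A: "c * u \<le> prob ?A" by (simp add: c_def)
    have "fst d \<le> (\<integral>\<omega>. (\<lambda>h. f h - r * indicator {x..<y} (fst h)) (shd \<omega>) \<partial>\<mu>)"
    proof (rule stability_region_bounded_linear_le[OF bounded_linear_fst _ _ _ _ d, where B = m])
      fix h s assume s: "mac_transmittable R P1 P2 h s"
      show "\<bar>fst s\<bar> \<le> m" by (rule mac_bound[OF s])
      note s1 = mac_transmittable_single_user_bounds(1)[OF s]
      show "fst s \<le> f h - r * indicator {x..<y} (fst h)"
      proof (cases "fst h \<in> {x..<y}")
        case True
        then have "x\<^sup>2 \<le> (fst h)\<^sup>2" "(fst h)\<^sup>2 < y\<^sup>2"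
          using xy by (auto intro!: power_mono power_strict_mono)
        then have *: "a \<le> (fst h)\<^sup>2 * Ptot" "(fst h)\<^sup>2 * Ptot < a * (1 + u)"
          using Ptot by (auto simp: x2 y2 field_simps)
        have "(fst h)\<^sup>2 * P1 < a"
        \<comment> \<open>Multiplying a strict inequality by \<open>1 - u\<close> needs
          \<open>u < 1\<close>; for \<open>u = 1\<close> the first user has no power at all.\<close>
        proof (cases "u = 1")
          case False
          then have "(fst h)\<^sup>2 * Ptot * (1 - u) < a * (1 + u) * (1 - u)"
            using * u by (intro mult_strict_right_mono) auto
          also have "\<dots> \<le> a" using a by (simp add: algebra_simps)
          finally show ?thesis by (simp add: P1 mult.assoc)
        qed (use a in \<open>simp add: P1\<close>)
        then have "fst s = 0" using r_less_iff[OF mac_in(1)[OF s] s1] P by simp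
        moreover have "r \<le> f h"
          unfolding f_def using R r * Ptot by (intro max_rate_ge) (auto simp: r_le_iff)
        ultimately show ?thesis using True by simp
      next
        case False
        have "(fst h)\<^sup>2 * P1 \<le> (fst h)\<^sup>2 * Ptot" using P by (intro mult_left_mono) auto
        moreover have "0 \<le> (fst h)\<^sup>2 * P1" using P by simp
        ultimately have "log 2 (1 + (fst h)\<^sup>2 * P1) \<le> log 2 (1 + (fst h)\<^sup>2 * Ptot)"
          by (intro log_mono) auto
        with s1 have "fst s \<le> f h"
          unfolding f_def using R mac_in(1)[OF s] by (intro max_rate_ge) auto
        with False show ?thesis by simp
      qed
    next
      show "\<bar>f h - r * indicator {x..<y} (fst h)\<bar> \<le> m" for h
        using f_bound[of h] m[OF r(1)] r by (auto simp: indicator_def)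
    qed measurable
    also have "\<dots> = (\<integral>\<omega>. f (shd \<omega>) - r * indicator ?A \<omega> \<partial>\<mu>)"
      by (rule Bochner_Integration.integral_cong) (auto simp: indicator_def h1_def)
    also have "\<dots> = (\<integral>\<omega>. f (shd \<omega>) \<partial>\<mu>) - r * prob ?A"
      by (rule diff_int) measurable
    finally have "r * prob ?A \<le> m * p" using d_fst by simp
    moreover have "r * (c * u) \<le> r * prob ?A" using A r by (intro mult_left_mono) auto
    ultimately have cost: "r * (c * u) \<le> m * p" by simp

    \<comment> \<open>Outside this event the second user cannot decode even \<open>r\<close> and is
      silent; inside it earns at most \<open>m\<close>.\<close>
    let ?B = "{\<omega> \<in> space \<mu>. a \<le> (h2 \<omega>)\<^sup>2 * P2}"
    have "snd d \<le> (\<integral>\<omega>. (\<lambda>h. m * indicator {a..} ((snd h)\<^sup>2 * P2)) (shd \<omega>) \<partial>\<mu>)"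
    proof (rule stability_region_bounded_linear_le[OF bounded_linear_snd _ _ _ _ d, where B = m])
      fix h s assume s: "mac_transmittable R P1 P2 h s"
      show "\<bar>snd s\<bar> \<le> m" by (rule mac_bound[OF s])
      show "snd s \<le> m * indicator {a..} ((snd h)\<^sup>2 * P2)"
        using m[OF mac_in(2)[OF s]] P
          r_less_iff[OF mac_in(2)[OF s] mac_transmittable_single_user_bounds(2)[OF s]]
        by (auto simp: indicator_def)
    next
      show "\<bar>m * indicator {a..} ((snd h)\<^sup>2 * P2)\<bar> \<le> m" for h :: "real \<times> real"
        using m_pos by (auto simp: indicator_def)
    qed measurable
    also have "\<dots> = (\<integral>\<omega>. m * indicator ?B \<omega> \<partial>\<mu>)"
      by (rule Bochner_Integration.integral_cong) (auto simp: indicator_def h2_def)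
    also have "\<dots> = m * prob ?B" by simp
    finally have gain: "r * p \<le> m * prob ?B" by (simp add: d_snd)
    show False
    \<comment> \<open>Without power the second user earns nothing, yet \<open>d\<close> demands
      \<open>r * p > 0\<close>. The case is separate because \<open>- \<beta> / u\<close> describes
      the tail only for \<open>u > 0\<close>.\<close>
    proof (cases "u = 0")
      case True
      then have "?B = {}" using a by (simp add: P2)
      with gain have "r * p \<le> 0" by simp
      then show False using r p by (simp add: mult_le_0_iff)
    next
      case False
      then have "u > 0" "P2 > 0" using u Ptot by (auto simp: P2)
      have "prob ?B = exp (- a / (2 * \<sigma>2\<^sup>2 * P2))"
        using a \<open>P2 > 0\<close> by (intro rayleigh_prob_gain_ge[OF h_meas(2) distr(2) \<sigma>(2)]) auto
      also have "- a / (2 * \<sigma>2\<^sup>2 * P2) = - \<beta> / u"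
        by (simp add: \<beta>_def P2 mult.commute mult.left_commute)
      finally have "r * p \<le> m * exp (- \<beta> / u)" using gain by simp
      from corner_exchange_bound[OF r(2) pos(3,2) \<open>u > 0\<close> p(1) less_imp_le[OF m_pos] cost this]
      have "q \<le> p" using m_pos by (simp add: q_def pos_divide_le_eq mult.commute mult.left_commute)
      with p show False by simp
    qed
  qed
  moreover have "stability_region \<mu> (mac_transmittable R P1 P2) \<subseteq> stability_region \<mu> (bc_transmittable R Ptot)"
    if "P1 \<ge> 0" "P2 \<ge> 0" "P1 + P2 = Ptot" for P1 P2
  proof (rule stability_region_mono_AE)
    show "bc_transmittable R Ptot h s"
      if "0 \<le> fst h" "0 \<le> snd h" "mac_transmittable R P1 P2 h s" for h s
      using bc_transmittable_if_mac_transmittable[OF that(3) R(3) that(1,2)] \<open>P1 + P2 = Ptot\<close> by simp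
    show "bc_transmittable R Ptot h (0, 0)" for h
      using R(2) Ptot by (intro bc_transmittable_second_user) (auto simp: rate_le_log_iff)
    show "AE \<omega> in \<mu>. 0 \<le> fst (shd \<omega>)" "AE \<omega> in \<mu>. 0 \<le> snd (shd \<omega>)"
      using rayleigh_AE_nonneg[OF h_meas(1) distr(1) \<sigma>(1)] rayleigh_AE_nonneg[OF h_meas(2) distr(2) \<sigma>(2)]
      by (simp_all add: h1_def h2_def)
  qed
  ultimately show ?thesis using d_bc by blast
qed

end
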